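(* Let $m>0$ and $g\in\mathbb{R}\setminus\{0\}$. Consider triples $(\phi_A,\phi_B,\omega)\in\mathbb{R}^3$ satisfying $$\omega\phi_A=g\phi_A^3-m\phi_B,\qquad \omega\phi_B=-m\phi_A+g\phi_B^3,\qquad \phi_A^2+\phi_B^2=1 .$$ Define $$x_\pm=\pm\sqrt{\tfrac12\left(1\pm\sqrt{1-4m^2/g^2}\right)},$$ which have the property $x_\mp=-m/(g\,x_\pm)$. Up to the global sign flip $(\phi_A,\phi_B)\mapsto(-\phi_A,-\phi_B)$, the solutions are exactly the following two pairs. (I,$\pm$) $(\phi_A,\phi_B)=(x_\pm,x_\mp)$ with $\omega=g$. These solutions exist only for $|g|\ge 2m$, where the inner square root in $x_\pm$ is real. (II,$\pm$) $(\phi_A,\phi_B)=\frac{1}{\sqrt2}(1,\pm1)$ with $\omega=\mp m+\frac g2$. These solutions exist for all $g\neq0$. Moreover, as $g\to\infty$ the solution (I,$+$) converges to $(1,0)$ and the solution (I,$-$) converges to $(0,1)$, while in the limit $|g|\to 2m^+$ the solutions (I,$\pm$) coincide (up to global sign) both with each other and with the appropriate one of the solutions (II,$\pm$).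
   Context: These equations are the conditions for a real, normalized discrete breather (time-periodic solution $e^{-i\omega t}\phi$) supported in a single two-site unit cell $\{A,B\}$ of the Su-Schrieffer-Heeger chain with cubic on-site nonlinearity of strength $g$, in the limit where the inter-cell hopping vanishes and the intra-cell hopping amplitude is $-m$. The solutions (II,$\pm$) are even ($+$) or odd ($-$) under the inversion exchanging $A$ and $B$.
   Formalization: The formula for x_- carries an extra factor sgn(g): as printed, x_+ x_- = -m/|g|, so the property x_∓ = -m/(g x_±) and solutions (I,±) fail for g < 0 (e.g. m = 1, g = -4). For g > 0 the formula is unchanged. *)

theory Defs
  imports Complex_Main
begin

text \<open>Solutions are triples \<open>(\<phi>\<^sub>A, \<phi>\<^sub>B, \<omega>)\<close>.\<close>

definition breather_solutions :: "real \<Rightarrow> real \<Rightarrow> (real \<times> real \<times> real) set" where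
  "breather_solutions m g =
     {(a, b, w). w * a = g * a ^ 3 - m * b \<and> w * b = - m * a + g * b ^ 3 \<and> a\<^sup>2 + b\<^sup>2 = 1}"

definition sign_flip :: "real \<times> real \<times> real \<Rightarrow> real \<times> real \<times> real" where
  "sign_flip = (\<lambda>(a, b, w). (- a, - b, w))"

definition x_plus :: "real \<Rightarrow> real \<Rightarrow> real" where
  "x_plus m g = sqrt (1 / 2 * (1 + sqrt (1 - 4 * m\<^sup>2 / g\<^sup>2)))"

text \<open>
  For \<open>g > 0\<close> this is \<open>- sqrt (1 / 2 * (1 - sqrt (1 - 4 * m\<^sup>2 / g\<^sup>2)))\<close>. The factor \<open>sgn g\<close> is
  what the relation \<open>x_plus m g * x_minus m g = - m / g\<close> demands for \<open>g < 0\<close>: without it the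
  product would be \<open>- m / \<bar>g\<bar>\<close>, and \<open>(x_plus m g, x_minus m g)\<close> would not solve
  the equations for negative \<open>g\<close>.
\<close>

definition x_minus :: "real \<Rightarrow> real \<Rightarrow> real" where
  "x_minus m g = - sgn g * sqrt (1 / 2 * (1 - sqrt (1 - 4 * m\<^sup>2 / g\<^sup>2)))"

text \<open>
  The HOL function \<open>sqrt\<close> is odd and hence total on the reals, so the type I triples are
  meaningful only for \<open>\<bar>g\<bar> \<ge> 2 * m\<close>.
\<close>

definition type_I_plus :: "real \<Rightarrow> real \<Rightarrow> real \<times> real \<times> real" where
  "type_I_plus m g = (x_plus m g, x_minus m g, g)"

definition type_I_minus :: "real \<Rightarrow> real \<Rightarrow> real \<times> real \<times> real" where
  "type_I_minus m g = (x_minus m g, x_plus m g, g)"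

definition type_II_plus :: "real \<Rightarrow> real \<Rightarrow> real \<times> real \<times> real" where
  "type_II_plus m g = (1 / sqrt 2, 1 / sqrt 2, - m + g / 2)"

definition type_II_minus :: "real \<Rightarrow> real \<Rightarrow> real \<times> real \<times> real" where
  "type_II_minus m g = (1 / sqrt 2, - 1 / sqrt 2, m + g / 2)"

end

theory Submission
  imports Defs
begin

text \<open>
  Eliminating \<open>\<omega>\<close> from the first two equations gives \<open>(a\<^sup>2 - b\<^sup>2) (g a b + m) = 0\<close>. Together with
  \<open>a\<^sup>2 + b\<^sup>2 = 1\<close>, the first factor yields the type II solutions. The second gives \<open>\<omega> = g\<close> and
  fixes the sum and the product of \<open>a\<^sup>2\<close> and \<open>b\<^sup>2\<close>, so these are the two roots
  \<open>x\<^sub>\<plusminus>\<^sup>2\<close> of \<open>t\<^sup>2 - t + m\<^sup>2 / g\<^sup>2\<close>.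
\<close>

section \<open>The amplitudes \<open>x_plus\<close> and \<open>x_minus\<close>\<close>

lemma discriminant_nonneg_iff:
  fixes m g :: real
  assumes "m > 0" "g \<noteq> 0"
  shows "1 - 4 * m\<^sup>2 / g\<^sup>2 \<ge> 0 \<longleftrightarrow> \<bar>g\<bar> \<ge> 2 * m"
proof -
  have "1 - 4 * m\<^sup>2 / g\<^sup>2 \<ge> 0 \<longleftrightarrow> (2 * m)\<^sup>2 \<le> \<bar>g\<bar>\<^sup>2"
    using assms by (simp add: field_simps power_mult_distrib)
  also have "\<dots> \<longleftrightarrow> 2 * m \<le> \<bar>g\<bar>"
    using assms by (subst power_mono_iff) auto
  finally show ?thesis .
qed

text \<open>With \<open>D\<close> the inner square root, the two squares are
  \<open>(1 + D) / 2\<close> and \<open>(1 - D) / 2\<close>. Their product is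
  \<open>(1 - D\<^sup>2) / 4 = (m / g)\<^sup>2\<close>, so the positive roots multiply to
  \<open>m / \<bar>g\<bar>\<close>, and the factor \<open>- sgn g\<close> in \<open>x_minus\<close>
  supplies the sign.\<close>

lemma x_plus_x_minus:
  fixes m g :: real
  assumes "m > 0" "g \<noteq> 0" "\<bar>g\<bar> \<ge> 2 * m"
  shows x_squares_sum: "(x_plus m g)\<^sup>2 + (x_minus m g)\<^sup>2 = 1"
    and x_product: "g * (x_plus m g * x_minus m g) = - m"
proof -
  define D where "D = sqrt (1 - 4 * m\<^sup>2 / g\<^sup>2)"
  \<comment> \<open>The total function \<open>sqrt\<close> squares back to its argument only if that
    is nonnegative; this is where \<open>\<bar>g\<bar> \<ge> 2 * m\<close> enters.\<close>
  have disc: "1 - 4 * m\<^sup>2 / g\<^sup>2 \<ge> 0"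
    using discriminant_nonneg_iff assms by blast
  have D: "0 \<le> D" "D\<^sup>2 = 1 - 4 * m\<^sup>2 / g\<^sup>2"
    using disc by (simp_all add: D_def)
  have "D \<le> 1"
    by (simp add: D_def)
  have p: "x_plus m g = sqrt (1 / 2 * (1 + D))"
    and q: "x_minus m g = - sgn g * sqrt (1 / 2 * (1 - D))"
    by (simp_all add: x_plus_def x_minus_def D_def)
  have "(sgn g)\<^sup>2 = 1"
    using assms by (simp add: sgn_real_def)
  then show "(x_plus m g)\<^sup>2 + (x_minus m g)\<^sup>2 = 1"
    using \<open>0 \<le> D\<close> \<open>D \<le> 1\<close> by (simp add: p q power_mult_distrib field_simps)
  have "sqrt (1 / 2 * (1 + D)) * sqrt (1 / 2 * (1 - D)) = sqrt ((1 - D\<^sup>2) / 4)"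
    unfolding real_sqrt_mult[symmetric]
    by (rule arg_cong[where f = sqrt]) (simp add: power2_eq_square field_simps)
  also have "(1 - D\<^sup>2) / 4 = (m / g)\<^sup>2"
    by (simp add: D power_divide)
  also have "sqrt \<dots> = m / \<bar>g\<bar>"
    using assms by (simp add: abs_divide)
  finally have "x_plus m g * x_minus m g = - sgn g * (m / \<bar>g\<bar>)"
    by (simp add: p q mult_ac)
  then show "g * (x_plus m g * x_minus m g) = - m"
    using assms by (simp add: sgn_real_def split: if_splits)
qed

section \<open>Consequences of the equations and of the relation
  \<open>g * (a * b) = - m\<close>\<close>

lemma solution_product_cases:
  fixes m g a b w :: real
  assumes "(a, b, w) \<in> breather_solutions m g"
  obtains "a\<^sup>2 = b\<^sup>2" | "g * (a * b) = - m"
proof -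
  from assms have e: "w * a = g * a ^ 3 - m * b" "w * b = - m * a + g * b ^ 3"
    by (simp_all add: breather_solutions_def)
  \<comment> \<open>The right-hand side is \<open>b\<close> times the first equation minus
    \<open>a\<close> times the second, so both terms equal \<open>w * a * b\<close> and
    cancel.\<close>
  have "(a\<^sup>2 - b\<^sup>2) * (g * (a * b) + m) = b * (g * a ^ 3 - m * b) - a * (- m * a + g * b ^ 3)"
    by (simp add: algebra_simps power2_eq_square power3_eq_cube)
  also have "\<dots> = 0"
    unfolding e[symmetric] by (simp add: mult_ac)
  finally show thesis
    using that by (auto simp: eq_neg_iff_add_eq_0)
qed

text \<open>Substituting \<open>m = - (g * (a * b))\<close> pulls a factor
  \<open>a\<^sup>2 + b\<^sup>2\<close> out of both right-hand sides, and normalization leaves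
  \<open>g * a\<close> and \<open>g * b\<close>.\<close>

lemma solution_if_product:
  fixes m g a b :: real
  assumes "g * (a * b) = - m" "a\<^sup>2 + b\<^sup>2 = 1"
  shows "(a, b, g) \<in> breather_solutions m g"
proof -
  have "m = - (g * (a * b))"
    using assms by simp
  then have "g * a ^ 3 - m * b = g * a * (a\<^sup>2 + b\<^sup>2)" "- m * a + g * b ^ 3 = g * b * (a\<^sup>2 + b\<^sup>2)"
    by (simp_all add: algebra_simps power2_eq_square power3_eq_cube)
  then show ?thesis
    by (simp add: assms breather_solutions_def)
qed

text \<open>The same amplitudes also solve the system with frequency \<open>g\<close>, so the first
  equation gives \<open>w * a = g * a\<close>, where \<open>a\<close> is nonzero because the product
  is.\<close>

lemma solution_if_product_frequency:
  fixes m g a b w :: real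
  assumes "(a, b, w) \<in> breather_solutions m g" "g * (a * b) = - m" "m \<noteq> 0"
  shows "w = g"
proof -
  have "a \<noteq> 0"
    using assms by auto
  moreover have "a\<^sup>2 + b\<^sup>2 = 1" "w * a = g * a ^ 3 - m * b"
    using assms by (simp_all add: breather_solutions_def)
  moreover from this have "(a, b, g) \<in> breather_solutions m g"
    using assms by (intro solution_if_product)
  then have "g * a = g * a ^ 3 - m * b"
    by (simp add: breather_solutions_def)
  ultimately show ?thesis
    by (metis mult_right_cancel)
qed

text \<open>The AM-GM inequality
  \<open>2 * \<bar>a * b\<bar> \<le> a\<^sup>2 + b\<^sup>2 = 1\<close>, multiplied by
  \<open>\<bar>g\<bar>\<close>.\<close>

lemma product_imp_amplitude_ge:
  fixes m g a b :: real
  assumes "g * (a * b) = - m" "a\<^sup>2 + b\<^sup>2 = 1"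
  shows "\<bar>g\<bar> \<ge> 2 * m"
proof -
  have "0 \<le> (\<bar>a\<bar> - \<bar>b\<bar>)\<^sup>2"
    by simp
  also have "\<dots> = 1 - 2 * \<bar>a * b\<bar>"
    using assms(2) by (simp add: power2_diff abs_mult)
  finally have "\<bar>g\<bar> * (2 * \<bar>a * b\<bar>) \<le> \<bar>g\<bar> * 1"
    by (intro mult_left_mono) auto
  moreover have "\<bar>g\<bar> * \<bar>a * b\<bar> = \<bar>m\<bar>"
    using assms(1) by (metis abs_minus_cancel abs_mult)
  ultimately show ?thesis
    by linarith
qed

text \<open>By Vieta, \<open>a\<^sup>2\<close> is a root of the quadratic with roots
  \<open>p\<^sup>2\<close> and \<open>q\<^sup>2\<close>. This fixes \<open>a\<close> up to sign and
  exchange; since \<open>c \<noteq> 0\<close>, cancelling in the product then fixes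
  \<open>b\<close>, including its sign.\<close>

lemma pair_determined_by_product:
  fixes a b p q c :: real
  assumes "a * b = c" "p * q = c" "a\<^sup>2 + b\<^sup>2 = 1" "p\<^sup>2 + q\<^sup>2 = 1" "c \<noteq> 0"
  shows "(a, b) \<in> {(p, q), (- p, - q), (q, p), (- q, - p)}"
proof -
  have "a\<^sup>2 * b\<^sup>2 = p\<^sup>2 * q\<^sup>2"
    using assms by (metis power_mult_distrib)
  have "(a\<^sup>2 - p\<^sup>2) * (a\<^sup>2 - q\<^sup>2) = a\<^sup>2 * (a\<^sup>2 - (p\<^sup>2 + q\<^sup>2)) + p\<^sup>2 * q\<^sup>2"
    by (simp add: algebra_simps)
  also have "\<dots> = a\<^sup>2 * (a\<^sup>2 - (a\<^sup>2 + b\<^sup>2)) + a\<^sup>2 * b\<^sup>2"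
    by (simp only: assms \<open>a\<^sup>2 * b\<^sup>2 = p\<^sup>2 * q\<^sup>2\<close>)
  also have "\<dots> = 0"
    by (simp add: algebra_simps)
  finally have "(a\<^sup>2 - p\<^sup>2) * (a\<^sup>2 - q\<^sup>2) = 0" .
  then consider "a = p" | "a = - p" | "a = q" | "a = - q"
    by (auto simp: power2_eq_iff)
  then show ?thesis
  proof cases
    case 1
    then have "p * b = p * q" "p \<noteq> 0"
      using assms by auto
    with 1 show ?thesis
      by simp
  next
    case 2
    then have "p * b = p * (- q)" "p \<noteq> 0"
      using assms by auto
    then have "b = - q"
      unfolding mult_cancel_left by blast
    with 2 show ?thesis
      by simp
  next
    case 3
    then have "q * b = q * p" "q \<noteq> 0"
      using assms by (auto simp: mult.commute)
    with 3 show ?thesis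
      by simp
  next
    case 4
    then have "q * b = q * (- p)" "q \<noteq> 0"
      using assms by (auto simp: mult.commute)
    then have "b = - p"
      unfolding mult_cancel_left by blast
    with 4 show ?thesis
      by simp
  qed
qed

section \<open>Classification of the solutions\<close>

lemma type_I_solutions:
  fixes m g :: real
  assumes "m > 0" "g \<noteq> 0" "\<bar>g\<bar> \<ge> 2 * m"
  shows "type_I_plus m g \<in> breather_solutions m g" "type_I_minus m g \<in> breather_solutions m g"
proof -
  have sum: "(x_plus m g)\<^sup>2 + (x_minus m g)\<^sup>2 = 1" and prod: "g * (x_plus m g * x_minus m g) = - m"
    using x_squares_sum x_product assms by blast+
  from solution_if_product[OF prod sum] show "type_I_plus m g \<in> breather_solutions m g"
    by (simp add: type_I_plus_def)
  from sum prod have "(x_minus m g)\<^sup>2 + (x_plus m g)\<^sup>2 = 1" "g * (x_minus m g * x_plus m g) = - m"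
    by (simp_all only: add.commute mult.commute)
  then show "type_I_minus m g \<in> breather_solutions m g"
    unfolding type_I_minus_def by (intro solution_if_product)
qed

lemma type_II_solutions:
  fixes m g :: real
  shows "type_II_plus m g \<in> breather_solutions m g" "type_II_minus m g \<in> breather_solutions m g"
  by (simp_all add: type_II_plus_def type_II_minus_def breather_solutions_def field_simps
      power2_eq_square power3_eq_cube)

lemma sign_flip_solution:
  fixes m g :: real
  assumes "t \<in> breather_solutions m g"
  shows "sign_flip t \<in> breather_solutions m g"
  using assms by (auto simp: sign_flip_def breather_solutions_def algebra_simps)

lemma solution_imp_type_I_or_II:
  fixes m g :: real
  assumes "m > 0" "g \<noteq> 0" "s \<in> breather_solutions m g"
  shows "\<exists>t. (s = t \<or> s = sign_flip t) \<and>
    (\<bar>g\<bar> \<ge> 2 * m \<and> t \<in> {type_I_plus m g, type_I_minus m g} \<or>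
     t \<in> {type_II_plus m g, type_II_minus m g})"
proof -
  obtain a b w where s: "s = (a, b, w)"
    by (cases s)
  note sol = assms(3)[unfolded s]
  then have norm: "a\<^sup>2 + b\<^sup>2 = 1" and eq: "w * a = g * a ^ 3 - m * b"
    by (simp_all add: breather_solutions_def)
  from sol show ?thesis
  proof (cases rule: solution_product_cases)
    case 1
    then have a2: "a\<^sup>2 = 1 / 2"
      using norm by simp
    then have "a \<noteq> 0"
      by auto
    have "a\<^sup>2 = (1 / sqrt 2)\<^sup>2"
      by (simp add: a2 power_divide)
    then have a: "a = 1 / sqrt 2 \<or> a = - (1 / sqrt 2)"
      by (simp only: power2_eq_iff)
    \<comment> \<open>This makes the first equation linear in \<open>a\<close>, so cancelling
      \<open>a\<close> yields the frequency.\<close>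
    have cube: "a ^ 3 = a / 2"
      using a2 by (simp add: power3_eq_cube power2_eq_square)
    from 1 consider "b = a" | "b = - a"
      by (auto simp: power2_eq_iff)
    then show ?thesis
    proof cases
      case 1
      have "w * a = (- m + g / 2) * a"
        using eq by (simp add: 1 cube algebra_simps)
      then have "w = - m + g / 2"
        using \<open>a \<noteq> 0\<close> by simp
      then have "s = type_II_plus m g \<or> s = sign_flip (type_II_plus m g)"
        using a by (auto simp: s 1 type_II_plus_def sign_flip_def)
      then show ?thesis
        by blast
    next
      case 2
      have "w * a = (m + g / 2) * a"
        using eq by (simp add: 2 cube algebra_simps)
      then have "w = m + g / 2"
        using \<open>a \<noteq> 0\<close> by simp
      then have "s = type_II_minus m g \<or> s = sign_flip (type_II_minus m g)"
        using a by (auto simp: s 2 type_II_minus_def sign_flip_def)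
      then show ?thesis
        by blast
    qed
  next
    case 2
    \<comment> \<open>The threshold follows from the existence of such a solution, which is why type
      I occurs only above it.\<close>
    have g: "\<bar>g\<bar> \<ge> 2 * m"
      using 2 norm by (rule product_imp_amplitude_ge)
    have w: "w = g"
      using solution_if_product_frequency[OF sol 2] assms(1) by simp
    have "a * b = - m / g" "x_plus m g * x_minus m g = - m / g"
      using 2 x_product[OF assms(1,2) g] assms(2) by (simp_all add: field_simps)
    then have "(a, b) \<in> {(x_plus m g, x_minus m g), (- x_plus m g, - x_minus m g),
        (x_minus m g, x_plus m g), (- x_minus m g, - x_plus m g)}"
      using assms norm x_squares_sum[OF assms(1,2) g] by (intro pair_determined_by_product[where c = "- m / g"]) auto
    then have "\<exists>t \<in> {type_I_plus m g, type_I_minus m g}. s = t \<or> s = sign_flip t"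
      by (auto simp: s w type_I_plus_def type_I_minus_def sign_flip_def)
    then show ?thesis
      using g by blast
  qed
qed

section \<open>Limits at infinite and at threshold nonlinearity\<close>

lemma tendsto_x_plus:
  assumes "((\<lambda>h. 4 * m\<^sup>2 / h\<^sup>2) \<longlongrightarrow> c) F"
  shows "(x_plus m \<longlongrightarrow> sqrt (1 / 2 * (1 + sqrt (1 - c)))) F"
  unfolding x_plus_def by (intro tendsto_intros assms)

text \<open>As for \<open>x_plus\<close>, the filter is left open: \<open>c = 0\<close> serves
  infinity and \<open>c = 1\<close> the threshold. The limit \<open>s\<close> of \<open>sgn\<close>
  is a separate parameter because it differs between the two thresholds.\<close>

lemma tendsto_x_minus:
  assumes "((\<lambda>h. 4 * m\<^sup>2 / h\<^sup>2) \<longlongrightarrow> c) F" "(sgn \<longlongrightarrow> s) F"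
  shows "(x_minus m \<longlongrightarrow> - s * sqrt (1 / 2 * (1 - sqrt (1 - c)))) F"
  unfolding x_minus_def by (intro tendsto_intros assms)

lemma x_limits_at_top:
  shows "(x_plus m \<longlongrightarrow> 1) at_top" "(x_minus m \<longlongrightarrow> 0) at_top"
proof -
  have c: "((\<lambda>h. 4 * m\<^sup>2 / h\<^sup>2) \<longlongrightarrow> 0) (at_top :: real filter)"
    by (intro tendsto_divide_0[OF tendsto_const] filterlim_at_top_imp_at_infinity
        filterlim_pow_at_top filterlim_ident) simp
  have "\<forall>\<^sub>F h in at_top. sgn h = (1 :: real)"
    using eventually_gt_at_top[of "0 :: real"] by eventually_elim simp
  then have s: "(sgn \<longlongrightarrow> (1 :: real)) at_top"
    by (rule tendsto_eventually)
  show "(x_plus m \<longlongrightarrow> 1) at_top"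
    using tendsto_x_plus[OF c] by simp
  show "(x_minus m \<longlongrightarrow> 0) at_top"
    using tendsto_x_minus[OF c s] by simp
qed

text \<open>The hypothesis on \<open>k\<close> covers both \<open>2 * m\<close> and
  \<open>- (2 * m)\<close>. There the inner root vanishes, so the amplitudes become equal in modulus
  and \<open>sgn k\<close> decides their relative sign. The set \<open>A\<close> allows one-sided
  limits.\<close>

lemma x_limits_at_threshold:
  fixes m k :: real
  assumes "m > 0" "k\<^sup>2 = (2 * m)\<^sup>2"
  shows "(x_plus m \<longlongrightarrow> 1 / sqrt 2) (at k within A)"
    and "(x_minus m \<longlongrightarrow> - sgn k / sqrt 2) (at k within A)"
proof -
  have "k \<noteq> 0"
    using assms by auto
  have "((\<lambda>h. 4 * m\<^sup>2 / h\<^sup>2) \<longlongrightarrow> 4 * m\<^sup>2 / k\<^sup>2) (at k within A)"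
    using \<open>k \<noteq> 0\<close> by (intro tendsto_intros) simp
  moreover have "4 * m\<^sup>2 / k\<^sup>2 = 1"
    using assms by (simp add: power_mult_distrib)
  ultimately have c: "((\<lambda>h. 4 * m\<^sup>2 / h\<^sup>2) \<longlongrightarrow> 1) (at k within A)"
    by simp
  show "(x_plus m \<longlongrightarrow> 1 / sqrt 2) (at k within A)"
    using tendsto_x_plus[OF c] by (simp add: real_sqrt_divide)
  have "(sgn \<longlongrightarrow> sgn k) (at k within A)"
    using \<open>k \<noteq> 0\<close> by (intro tendsto_intros)
  from tendsto_x_minus[OF c this]
  show "(x_minus m \<longlongrightarrow> - sgn k / sqrt 2) (at k within A)"
    by (simp add: real_sqrt_divide)
qed

text \<open>The limit of \<open>\<bar>g\<bar>\<close> to \<open>2 * m\<close> from above splits by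
  the sign of \<open>g\<close>: from the right at \<open>2 * m\<close> both type I branches meet the
  odd solution, one of them up to global sign, and from the left at \<open>- (2 * m)\<close> both
  meet the even one.\<close>

theorem mainTheorem1:
  fixes m g :: real
  assumes "m > 0" and "g \<noteq> 0"
  shows
    "(1 - 4 * m\<^sup>2 / g\<^sup>2 \<ge> 0 \<longleftrightarrow> \<bar>g\<bar> \<ge> 2 * m)
     \<and> (\<bar>g\<bar> \<ge> 2 * m \<longrightarrow>
          x_minus m g = - m / (g * x_plus m g) \<and> x_plus m g = - m / (g * x_minus m g))
     \<and> (\<forall>s. s \<in> breather_solutions m g \<longleftrightarrow>
          (\<exists>t. (s = t \<or> s = sign_flip t) \<and>
               (\<bar>g\<bar> \<ge> 2 * m \<and> t \<in> {type_I_plus m g, type_I_minus m g} \<or>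
                t \<in> {type_II_plus m g, type_II_minus m g})))
     \<and> ((\<lambda>h. (x_plus m h, x_minus m h)) \<longlongrightarrow> (1, 0)) at_top
     \<and> ((\<lambda>h. (x_minus m h, x_plus m h)) \<longlongrightarrow> (0, 1)) at_top
     \<and> (type_I_plus m \<longlongrightarrow> type_II_minus m (2 * m)) (at_right (2 * m))
     \<and> (type_I_minus m \<longlongrightarrow> sign_flip (type_II_minus m (2 * m))) (at_right (2 * m))
     \<and> (type_II_minus m \<longlongrightarrow> type_II_minus m (2 * m)) (at_right (2 * m))
     \<and> (type_I_plus m \<longlongrightarrow> type_II_plus m (- (2 * m))) (at_left (- (2 * m)))
     \<and> (type_I_minus m \<longlongrightarrow> type_II_plus m (- (2 * m))) (at_left (- (2 * m)))
     \<and> (type_II_plus m \<longlongrightarrow> type_II_plus m (- (2 * m))) (at_left (- (2 * m)))"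
proof (intro conjI allI impI iffI)
  assume g: "\<bar>g\<bar> \<ge> 2 * m"
  have prod: "g * (x_plus m g * x_minus m g) = - m"
    using x_product[OF assms g] .
  then have "x_plus m g \<noteq> 0" "x_minus m g \<noteq> 0"
    using assms by auto
  then show "x_minus m g = - m / (g * x_plus m g)" "x_plus m g = - m / (g * x_minus m g)"
    using prod assms by (simp_all add: field_simps)
next
  fix s
  assume "s \<in> breather_solutions m g"
  then show "\<exists>t. (s = t \<or> s = sign_flip t) \<and>
      (\<bar>g\<bar> \<ge> 2 * m \<and> t \<in> {type_I_plus m g, type_I_minus m g} \<or>
       t \<in> {type_II_plus m g, type_II_minus m g})"
    by (rule solution_imp_type_I_or_II[OF assms])
next
  fix s
  assume "\<exists>t. (s = t \<or> s = sign_flip t) \<and>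
      (\<bar>g\<bar> \<ge> 2 * m \<and> t \<in> {type_I_plus m g, type_I_minus m g} \<or>
       t \<in> {type_II_plus m g, type_II_minus m g})"
  then show "s \<in> breather_solutions m g"
    using type_I_solutions[OF assms] type_II_solutions sign_flip_solution by blast
next
  show "1 - 4 * m\<^sup>2 / g\<^sup>2 \<ge> 0 \<Longrightarrow> \<bar>g\<bar> \<ge> 2 * m" "\<bar>g\<bar> \<ge> 2 * m \<Longrightarrow> 1 - 4 * m\<^sup>2 / g\<^sup>2 \<ge> 0"
    using discriminant_nonneg_iff[OF assms] by blast+
next
  show "((\<lambda>h. (x_plus m h, x_minus m h)) \<longlongrightarrow> (1, 0)) at_top"
    "((\<lambda>h. (x_minus m h, x_plus m h)) \<longlongrightarrow> (0, 1)) at_top"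
    by (intro tendsto_Pair x_limits_at_top)+
next
  \<comment> \<open>Here \<open>sgn k = 1\<close>, so \<open>x_minus\<close> tends to
    \<open>- 1 / sqrt 2\<close>: the limit is odd, and exchanging the sites flips its global
    sign.\<close>
  have "(2 * m)\<^sup>2 = (2 * m)\<^sup>2" ..
  note lim = x_limits_at_threshold[OF assms(1) this, where A = "{2 * m<..}"]
  show "(type_I_plus m \<longlongrightarrow> type_II_minus m (2 * m)) (at_right (2 * m))"
    "(type_I_minus m \<longlongrightarrow> sign_flip (type_II_minus m (2 * m))) (at_right (2 * m))"
    using assms(1) lim
    by (auto simp: type_I_plus_def[abs_def] type_I_minus_def[abs_def] type_II_minus_def
        sign_flip_def intro!: tendsto_Pair)
  show "(type_II_minus m \<longlongrightarrow> type_II_minus m (2 * m)) (at_right (2 * m))"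
    unfolding type_II_minus_def by (intro tendsto_intros) simp_all
next
  \<comment> \<open>Here \<open>sgn k = - 1\<close>, so both amplitudes tend to
    \<open>1 / sqrt 2\<close> and no sign flip arises.\<close>
  have "(- (2 * m))\<^sup>2 = (2 * m)\<^sup>2"
    by simp
  note lim = x_limits_at_threshold[OF assms(1) this, where A = "{..<- (2 * m)}"]
  show "(type_I_plus m \<longlongrightarrow> type_II_plus m (- (2 * m))) (at_left (- (2 * m)))"
    "(type_I_minus m \<longlongrightarrow> type_II_plus m (- (2 * m))) (at_left (- (2 * m)))"
    using assms(1) lim
    by (auto simp: type_I_plus_def[abs_def] type_I_minus_def[abs_def] type_II_plus_def
        intro!: tendsto_Pair)
  show "(type_II_plus m \<longlongrightarrow> type_II_plus m (- (2 * m))) (at_left (- (2 * m)))"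
    unfolding type_II_plus_def by (intro tendsto_intros) simp_all
qed

end
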